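(* Let $G=\langle N,K,\mathbf w,v_1,v_2\rangle$ be a weighted competition game with two firms, $K=\{1,2\}$ (the two value functions $v_1,v_2$ may be different). Then $G$ admits a proportional PSPE, i.e. there is a PSPE $(P,\mathbf X)$ of $G$ in which the payment policy of every firm is proportional.
   Context: Competition game: $N$ is a finite set of workers, $K$ a finite set of $k\ge 2$ firms, and each firm $i\in K$ has a nondecreasing value function $v_i:2^N\to\mathbb R_+$ with $v_i(\emptyset)=0$. In step 1 all firms simultaneously choose payment policies $\mathbf x_i=(x_{ij})_{j\in N}\in\mathbb R^N$ (payments may be negative). In step 2 each worker chooses a firm or stays idle. An outcome is a pair $(P,\mathbf X)$ where $\mathbf X=(x_{ij})$ and $P=(S_0,(S_i)_{i\in K})$ is a partition of $N$ ($S_0$ = idle workers; parts may be empty). Put $x_{0j}=0$. A worker $j\in S_i$ receives $\hat x_j=x_{ij}$; firm $i$ has profit $r_i(P,\mathbf X)=v_i(S_i)-\sum_{j\in S_i}x_{ij}$. PSPE: let $\mathcal P(\mathbf X)$ be the set of partitions such that every worker $j\in S_i$ ($i\in K\cup\{0\}$) satisfies $x_{ij}=\max_{i'\in K\cup\{0\}}x_{i'j}$. A tie-breaking rule is a map $\mathbf X\mapsto P(\mathbf X)\in\mathcal P(\mathbf X)$. An outcome $(P,\mathbf X)$ is a pure subgame perfect equilibrium (PSPE) if for some tie-breaking rule: (a) $P=P(\mathbf X)$; and (b) for every $i\in K$ and every policy $\mathbf x_i'$, $r_i(P',\mathbf X')\le r_i(P,\mathbf X)$, where $\mathbf X'=(\mathbf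 x_{-i},\mathbf x_i')$ and $P'=P(\mathbf X')$. Weighted game: each worker $j$ has a positive integer weight $w_j$, and $v_i(S)=v_i\big(\sum_{j\in S}w_j\big)$ for a nondecreasing function $v_i:\mathbb N\to\mathbb R_+$ with $v_i(0)=0$ whose marginals $v_i(t+1)-v_i(t)$ are nonincreasing in $t$. A policy $\mathbf x_i$ is proportional if $x_{ij}w_{j'}=x_{ij'}w_j$ for all $j,j'\in N$, i.e. $\mathbf x_i=\delta_i\mathbf w$ for some $\delta_i\in\mathbb R$. *)

theory Defs
  imports Complex_Main "HOL-Library.FuncSet" "HOL-Library.Disjoint_Sets"
begin

locale competition_game =
  fixes N :: "'a set"
    and K :: "'k set"
    and v :: "'k \<Rightarrow> 'a set \<Rightarrow> real"
  assumes finite_workers: "finite N"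
    and finite_firms: "finite K"
    and two_firms: "2 \<le> card K"
    and value_empty: "i \<in> K \<Longrightarrow> v i {} = 0"
    and value_nonneg: "i \<in> K \<Longrightarrow> S \<subseteq> N \<Longrightarrow> 0 \<le> v i S"
    and value_mono: "i \<in> K \<Longrightarrow> S \<subseteq> T \<Longrightarrow> T \<subseteq> N \<Longrightarrow> v i S \<le> v i T"

text \<open>Policies, profiles and partitions are extensional functions, so that each represents exactly
  one object over \<open>N\<close> and \<open>K\<close> and a tie-breaking rule cannot depend on values outside them.\<close>

definition policies :: "'a set \<Rightarrow> ('a \<Rightarrow> real) set" where
  "policies N = N \<rightarrow>\<^sub>E UNIV"

definition profiles :: "'a set \<Rightarrow> 'k set \<Rightarrow> ('k \<Rightarrow> 'a \<Rightarrow> real) set" where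
  "profiles N K = K \<rightarrow>\<^sub>E policies N"

text \<open>A worker's options are \<open>K \<union> {0}\<close>: \<open>None\<close> is the option \<open>0\<close> of staying idle.\<close>

definition options :: "'k set \<Rightarrow> 'k option set" where
  "options K = insert None (Some ` K)"

fun pay :: "('k \<Rightarrow> 'a \<Rightarrow> real) \<Rightarrow> 'k option \<Rightarrow> 'a \<Rightarrow> real" where
  "pay X None j = 0"
| "pay X (Some i) j = X i j"

definition partitions :: "'a set \<Rightarrow> 'k set \<Rightarrow> ('k option \<Rightarrow> 'a set) set" where
  "partitions N K =
     {P \<in> options K \<rightarrow>\<^sub>E Pow N. disjoint_family_on P (options K) \<and> (\<Union>i\<in>options K. P i) = N}"

definition optimal_partitions ::
    "'a set \<Rightarrow> 'k set \<Rightarrow> ('k \<Rightarrow> 'a \<Rightarrow> real) \<Rightarrow> ('k option \<Rightarrow> 'a set) set" where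
  "optimal_partitions N K X =
     {P \<in> partitions N K.
        \<forall>i\<in>options K. \<forall>j\<in>P i. pay X i j = Max ((\<lambda>i'. pay X i' j) ` options K)}"

definition tie_breaking_rule ::
    "'a set \<Rightarrow> 'k set \<Rightarrow> (('k \<Rightarrow> 'a \<Rightarrow> real) \<Rightarrow> 'k option \<Rightarrow> 'a set) \<Rightarrow> bool" where
  "tie_breaking_rule N K \<tau> \<longleftrightarrow> (\<forall>X\<in>profiles N K. \<tau> X \<in> optimal_partitions N K X)"

definition profit ::
    "('k \<Rightarrow> 'a set \<Rightarrow> real) \<Rightarrow> ('k option \<Rightarrow> 'a set) \<Rightarrow> ('k \<Rightarrow> 'a \<Rightarrow> real) \<Rightarrow> 'k \<Rightarrow> real" where
  "profit v P X i = v i (P (Some i)) - (\<Sum>j\<in>P (Some i). X i j)"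

definition PSPE ::
    "'a set \<Rightarrow> 'k set \<Rightarrow> ('k \<Rightarrow> 'a set \<Rightarrow> real) \<Rightarrow>
     ('k option \<Rightarrow> 'a set) \<Rightarrow> ('k \<Rightarrow> 'a \<Rightarrow> real) \<Rightarrow> bool" where
  "PSPE N K v P X \<longleftrightarrow>
     P \<in> partitions N K \<and> X \<in> profiles N K \<and>
     (\<exists>\<tau>. tie_breaking_rule N K \<tau> \<and> P = \<tau> X \<and>
        (\<forall>i\<in>K. \<forall>x'\<in>policies N.
           let X' = X(i := x') in profit v (\<tau> X') X' i \<le> profit v P X i))"

locale weighted_competition_game =
  fixes N :: "'a set"
    and K :: "'k set"
    and w :: "'a \<Rightarrow> nat"
    and v :: "'k \<Rightarrow> nat \<Rightarrow> real"
  assumes finite_workers: "finite N"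
    and finite_firms: "finite K"
    and two_firms: "2 \<le> card K"
    and weight_pos: "j \<in> N \<Longrightarrow> 0 < w j"
    and value_zero: "i \<in> K \<Longrightarrow> v i 0 = 0"
    and value_nonneg: "i \<in> K \<Longrightarrow> 0 \<le> v i t"
    and value_mono: "i \<in> K \<Longrightarrow> mono (v i)"
    and marginals_antimono: "i \<in> K \<Longrightarrow> antimono (\<lambda>t. v i (t + 1) - v i t)"

definition weighted_value :: "('a \<Rightarrow> nat) \<Rightarrow> ('k \<Rightarrow> nat \<Rightarrow> real) \<Rightarrow> 'k \<Rightarrow> 'a set \<Rightarrow> real" where
  "weighted_value w v i S = v i (\<Sum>j\<in>S. w j)"

sublocale weighted_competition_game \<subseteq> game: competition_game N K "weighted_value w v"
proof
  show "weighted_value w v i S \<le> weighted_value w v i T"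
    if "i \<in> K" "S \<subseteq> T" "T \<subseteq> N" for i S T
  proof -
    have "finite T"
      using that(3) finite_workers by (rule finite_subset)
    then have "sum w S \<le> sum w T"
      using that(2) by (intro sum_mono2) auto
    then show ?thesis
      unfolding weighted_value_def using value_mono[OF that(1)] by (rule monoD[rotated])
  qed
qed (auto simp: weighted_value_def finite_workers finite_firms two_firms value_zero value_nonneg)

definition proportional :: "'a set \<Rightarrow> ('a \<Rightarrow> nat) \<Rightarrow> ('a \<Rightarrow> real) \<Rightarrow> bool" where
  "proportional N w x \<longleftrightarrow> (\<forall>j\<in>N. \<forall>j'\<in>N. x j * real (w j') = x j' * real (w j))"

end

(* A common price p for the workers that supports an efficient allocation (a Walrasian equilibrium)
   is a PSPE: when one firm deviates, all ties are broken against it, so it can only hire a set T at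
   a cost of at least p(T). For two firms of a weighted game a price delta * w of this kind exists:
   let A be the set of weights of sets of workers, W the total weight, and let t in A maximize
   v1(t) + v2(W - t). By concavity and optimality, the slopes over A of v1 to the right of t and of
   v2 to the right of W - t are at most the corresponding slopes to the left, and any nonnegative
   delta that separates the two families will do. *)

theory Submission imports Defs begin

section \<open>Tie-breaking rules and common prices\<close>

definition choice_partition :: "'a set \<Rightarrow> 'k set \<Rightarrow> ('a \<Rightarrow> 'k option) \<Rightarrow> 'k option \<Rightarrow> 'a set" where
  "choice_partition N K c = (\<lambda>i\<in>options K. {j \<in> N. c j = i})"

lemma choice_partition_optimal:
  assumes "\<And>j. j \<in> N \<Longrightarrow> c j \<in> options K"
    and "\<And>j. j \<in> N \<Longrightarrow> pay X (c j) j = Max ((\<lambda>i'. pay X i' j) ` options K)"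
  shows "choice_partition N K c \<in> optimal_partitions N K X"
  using assms
  by (auto simp: optimal_partitions_def partitions_def choice_partition_def disjoint_family_on_def)

lemma options_finite: "finite K \<Longrightarrow> finite (options K)"
  by (simp add: options_def)

text \<open>Supplies the value of a tie-breaking rule at profiles that are not a unilateral
  deviation from the equilibrium.\<close>

lemma optimal_partitions_nonempty:
  assumes "finite K"
  shows "optimal_partitions N K X \<noteq> {}"
proof -
  have "\<exists>o'\<in>options K. pay X o' j = Max ((\<lambda>i'. pay X i' j) ` options K)" for j
  proof -
    have "options K \<noteq> {}"
      by (simp add: options_def)
    then have "Max ((\<lambda>i'. pay X i' j) ` options K) \<in> (\<lambda>i'. pay X i' j) ` options K"
      using options_finite[OF assms] by (intro Max_in) auto
    then show ?thesis
      by auto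
  qed
  then obtain c where "\<And>j. c j \<in> options K"
      "\<And>j. pay X (c j) j = Max ((\<lambda>i'. pay X i' j) ` options K)"
    by metis
  then show ?thesis
    using choice_partition_optimal[of N c K X] by blast
qed

text \<open>Breaking ties against firm \<open>i\<close> leaves it only workers whom it pays more
  than \<open>p\<close>. Whatever set it hires then costs at least its price, and \<open>r\<close>
  bounds the profit from buying any set at that price.\<close>

lemma deviation_unprofitable:
  fixes p :: "'a \<Rightarrow> real"
  assumes "finite N" "finite K" "2 \<le> card K" "i \<in> K"
    and X: "\<And>i' j. i' \<in> K \<Longrightarrow> i' \<noteq> i \<Longrightarrow> j \<in> N \<Longrightarrow> X i' j = p j"
    and p: "\<And>j. j \<in> N \<Longrightarrow> 0 \<le> p j"
    and best: "\<And>T. T \<subseteq> N \<Longrightarrow> v i T - sum p T \<le> r"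
  shows "\<exists>Q\<in>optimal_partitions N K X. profit v Q X i \<le> r"
proof -
  have "K - {i} \<noteq> {}"
    using assms(2-4) by (metis card_0_eq card_Diff_singleton diff_is_0_eq finite_Diff
        not_less_eq_eq numeral_2_eq_2 One_nat_def)
  then obtain i' where i': "i' \<in> K" "i' \<noteq> i"
    by blast
  \<comment> \<open>A second firm \<open>i'\<close> pays exactly \<open>p\<close>, so it can absorb
    every worker not strictly better off with \<open>i\<close>. As \<open>p\<close> is nonnegative,
    idleness never beats this choice.\<close>
  define c where "c j = (if X i j > p j then Some i else Some i')" for j
  define T where "T = {j \<in> N. X i j > p j}"
  define Q where "Q = choice_partition N K c"
  have "Q \<in> optimal_partitions N K X"
    unfolding Q_def
  proof (rule choice_partition_optimal)
    fix j assume j: "j \<in> N"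
    show c: "c j \<in> options K"
      using i' \<open>i \<in> K\<close> by (auto simp: c_def options_def)
    have "pay X k j \<le> pay X (c j) j" if "k \<in> options K" for k
    proof (cases k)
      case None
      then show ?thesis
        using p[OF j] X[OF i' j] by (auto simp: c_def)
    next
      case (Some l)
      then have "l \<in> K"
        using that by (auto simp: options_def)
      then show ?thesis
        using Some X[OF i' j] X[OF \<open>l \<in> K\<close> _ j] by (cases "l = i") (auto simp: c_def)
    qed
    then show "pay X (c j) j = Max ((\<lambda>i'. pay X i' j) ` options K)"
      using c options_finite[OF \<open>finite K\<close>] by (intro Max_eqI[symmetric]) auto
  qed
  moreover have "Q (Some i) = T"
    using i' \<open>i \<in> K\<close> by (auto simp: Q_def choice_partition_def options_def c_def T_def)
  moreover have "sum p T \<le> sum (X i) T"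
    by (intro sum_mono) (auto simp: T_def)
  moreover have "v i T - sum p T \<le> r"
    by (intro best) (auto simp: T_def)
  ultimately show ?thesis
    by (intro bexI[of _ Q]) (auto simp: profit_def)
qed

text \<open>The hypotheses on \<open>P\<close> and \<open>p\<close> describe a Walrasian equilibrium
  without idle workers: each firm already holds a most profitable set at prices \<open>p\<close>.
  All firms offer \<open>p\<close>, so every assignment to firms is optimal for the workers.\<close>

lemma walrasian_PSPE:
  fixes p :: "'a \<Rightarrow> real"
  assumes "finite N" "finite K" "2 \<le> card K"
    and p: "\<And>j. j \<in> N \<Longrightarrow> 0 \<le> p j"
    and P: "P \<in> partitions N K"
    and idle: "P None = {}"
    and best: "\<And>i T. i \<in> K \<Longrightarrow> T \<subseteq> N \<Longrightarrow>
      v i T - sum p T \<le> v i (P (Some i)) - sum p (P (Some i))"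
  shows "PSPE N K v P (\<lambda>i\<in>K. \<lambda>j\<in>N. p j)"
proof -
  define X where "X = (\<lambda>i\<in>K. \<lambda>j\<in>N. p j)"
  have PN: "P k \<subseteq> N" if "k \<in> options K" for k
    using P that by (auto simp: partitions_def)
  have X_profile: "X \<in> profiles N K"
    by (auto simp: X_def profiles_def policies_def)
  have P_optimal: "P \<in> optimal_partitions N K X"
    unfolding optimal_partitions_def
  proof (intro CollectI conjI P ballI)
    fix k j assume k: "k \<in> options K" "j \<in> P k"
    then obtain i where i: "k = Some i" "i \<in> K"
      using idle by (auto simp: options_def)
    have j: "j \<in> N"
      using k PN by blast
    have "pay X l j \<le> pay X k j" if "l \<in> options K" for l
      using i j p that by (cases l) (auto simp: options_def X_def)
    then show "pay X k j = Max ((\<lambda>i'. pay X i' j) ` options K)"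
      using options_finite[OF \<open>finite K\<close>] k(1) by (intro Max_eqI[symmetric]) auto
  qed
  have profit_P: "profit v P X i = v i (P (Some i)) - sum p (P (Some i))" if "i \<in> K" for i
  proof -
    have "sum (X i) (P (Some i)) = sum p (P (Some i))"
      using that PN[of "Some i"] by (intro sum.cong) (auto simp: X_def options_def)
    then show ?thesis
      by (simp add: profit_def)
  qed
  \<comment> \<open>Everything demanded of the rule at a single profile \<open>X'\<close>. The
    existence of a good \<open>Q\<close> can thus be shown profile by profile, and the rule is
    obtained by choice.\<close>
  define punishes where "punishes X' Q \<longleftrightarrow> (X' = X \<longrightarrow> Q = P) \<and>
    (\<forall>i\<in>K. \<forall>x'. X' = X(i := x') \<longrightarrow> profit v Q X' i \<le> profit v P X i)" for X' Q
  have "\<exists>Q\<in>optimal_partitions N K X'. punishes X' Q" for X'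
  proof (cases "X' = X")
    case True
    then show ?thesis
      using P_optimal by (auto simp: punishes_def)
  next
    case neq: False
    show ?thesis
    proof (cases "\<exists>i\<in>K. \<exists>x'. X' = X(i := x')")
      case True
      then obtain i x' where i: "i \<in> K" "X' = X(i := x')"
        by blast
      have "\<exists>Q\<in>optimal_partitions N K X'. profit v Q X' i \<le> profit v P X i"
        by (rule deviation_unprofitable[where p = p])
          (use assms(1-3) i p best profit_P in \<open>auto simp: X_def\<close>)
      \<comment> \<open>A profile other than \<open>X\<close> has at most one deviator, so a
        partition chosen against \<open>i\<close> answers every way of reading \<open>X'\<close> as
        a deviation.\<close>
      moreover have "i' = i" if "X' = X(i' := x'')" for i' x''
        using that i(2) neq by (metis fun_upd_other fun_upd_triv fun_upd_upd fun_upd_same)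
      ultimately show ?thesis
        using neq unfolding punishes_def by blast
    next
      case False
      then show ?thesis
        using neq optimal_partitions_nonempty[OF \<open>finite K\<close>, of N X'] by (auto simp: punishes_def)
    qed
  qed
  then obtain \<tau> where \<tau>: "\<And>X'. \<tau> X' \<in> optimal_partitions N K X'" "\<And>X'. punishes X' (\<tau> X')"
    by metis
  have "PSPE N K v P X"
    unfolding PSPE_def Let_def
    using P X_profile \<tau> by (auto simp: punishes_def tie_breaking_rule_def intro!: exI[of _ \<tau>])
  then show ?thesis
    by (simp add: X_def)
qed

section \<open>Slopes of concave functions on the naturals\<close>

text \<open>The marginals from \<open>b\<close> on are at most the one at \<open>b\<close>, and
  those before \<open>b\<close> are at least that large; summing them up or down from
  \<open>b\<close> gives the bound.\<close>

lemma concave_tangent: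
  fixes f :: "nat \<Rightarrow> real"
  assumes "antimono (\<lambda>t. f (t + 1) - f t)"
  shows "f s \<le> f b + (f (b + 1) - f b) * (real s - real b)"
proof (cases "b \<le> s")
  case True
  then show ?thesis
  proof (induction s rule: dec_induct)
    case (step n)
    with antimonoD[OF assms, of b n] show ?case
      by (simp add: algebra_simps)
  qed simp
next
  case False
  then have "s \<le> b" by simp
  then show ?thesis
  proof (induction s rule: inc_induct)
    case (step n)
    with antimonoD[OF assms, of n b] show ?case
      by (simp add: algebra_simps)
  qed simp
qed

text \<open>The marginal \<open>d\<close> at \<open>b\<close> lies between the two slopes, by the
  tangent bound at \<open>c\<close> and at \<open>a\<close>.\<close>

lemma concave_slopes:
  fixes f :: "nat \<Rightarrow> real"
  assumes "antimono (\<lambda>t. f (t + 1) - f t)" "a < b" "b < c"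
  shows "(f c - f b) / (real c - real b) \<le> (f b - f a) / (real b - real a)"
proof -
  define d where "d = f (b + 1) - f b"
  have "f c - f b \<le> d * (real c - real b)" "d * (real b - real a) \<le> f b - f a"
    using concave_tangent[OF assms(1), of c b] concave_tangent[OF assms(1), of a b]
    by (simp_all add: d_def algebra_simps)
  then have "(f c - f b) / (real c - real b) \<le> d" "d \<le> (f b - f a) / (real b - real a)"
    using assms(2,3) by (simp_all add: field_simps)
  then show ?thesis
    by simp
qed

text \<open>The slope from \<open>a\<close> to \<open>c\<close> is a weighted mean of the slopes
  from \<open>a\<close> to \<open>b\<close> and from \<open>b\<close> to \<open>c\<close>, the
  second of which is no larger. The next lemma is the mirror image.\<close>

lemma concave_slope_right_antimono:
  fixes f :: "nat \<Rightarrow> real"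
  assumes "antimono (\<lambda>t. f (t + 1) - f t)" "a < b" "b \<le> c"
  shows "(f c - f a) / (real c - real a) \<le> (f b - f a) / (real b - real a)"
proof (cases "b = c")
  case False
  then show ?thesis
    using concave_slopes[OF assms(1,2), of c] assms by (simp add: field_simps)
qed simp

lemma concave_slope_left_antimono:
  fixes f :: "nat \<Rightarrow> real"
  assumes "antimono (\<lambda>t. f (t + 1) - f t)" "a \<le> b" "b < c"
  shows "(f c - f b) / (real c - real b) \<le> (f c - f a) / (real c - real a)"
proof (cases "a = b")
  case False
  then show ?thesis
    using concave_slopes[OF assms(1) _ assms(3), of a] assms by (simp add: field_simps)
qed simp

section \<open>Separating slopes at an optimal split\<close>

text \<open>If both firms moved by the same amount, this would be optimality of \<open>t\<close>.
  The amounts \<open>s - t\<close> and \<open>W - t - s'\<close> may differ, so the smaller one is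
  used for both, and concavity compares the slopes over the shorter and the longer interval.\<close>

lemma slope_exchange:
  fixes f g :: "nat \<Rightarrow> real"
  assumes f: "antimono (\<lambda>t. f (t + 1) - f t)" and g: "antimono (\<lambda>t. g (t + 1) - g t)"
    and A: "A \<subseteq> {..W}" "\<And>s. s \<in> A \<Longrightarrow> W - s \<in> A"
    and opt: "\<And>s. s \<in> A \<Longrightarrow> f s + g (W - s) \<le> f t + g (W - t)"
    and s: "s \<in> A" "t < s" and s': "s' \<in> A" "s' < W - t"
  shows "(f s - f t) / (real s - real t) \<le> (g (W - t) - g s') / (real (W - t) - real s')"
proof -
  \<comment> \<open>The split reached by the smaller move. It stays in \<open>A\<close> because
    \<open>A\<close> is closed under complement in \<open>W\<close>.\<close>
  define m where "m = min s (W - s')"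
  have m: "m \<in> A" "t < m" "m \<le> s" "m \<le> W" "s' \<le> W - m"
    using s s' A by (auto simp: m_def min_def)
  have "(f s - f t) / (real s - real t) \<le> (f m - f t) / (real m - real t)"
    using concave_slope_right_antimono[OF f] m by blast
  also have "\<dots> \<le> (g (W - t) - g (W - m)) / (real m - real t)"
    using opt[OF m(1)] m by (intro divide_right_mono) auto
  also have "real m - real t = real (W - t) - real (W - m)"
    using m by simp
  also have "(g (W - t) - g (W - m)) / \<dots> \<le> (g (W - t) - g s') / (real (W - t) - real s')"
    using concave_slope_left_antimono[OF g, of s' "W - m" "W - t"] m by simp
  finally show ?thesis .
qed

text \<open>Multiplying each slope bound by its positive denominator gives the inequality on either
  side of \<open>t\<close>.\<close>

lemma slope_bounds_maximizer:
  fixes f :: "nat \<Rightarrow> real"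
  assumes "\<And>s. s \<in> A \<Longrightarrow> t < s \<Longrightarrow> (f s - f t) / (real s - real t) \<le> \<delta>"
    and "\<And>s. s \<in> A \<Longrightarrow> s < t \<Longrightarrow> \<delta> \<le> (f t - f s) / (real t - real s)"
    and "s \<in> A"
  shows "f s - \<delta> * real s \<le> f t - \<delta> * real t"
  using assms(1,2)[OF assms(3)] by (cases s t rule: linorder_cases) (auto simp: field_simps)

lemma supporting_price:
  fixes f g :: "nat \<Rightarrow> real"
  assumes f: "mono f" "antimono (\<lambda>t. f (t + 1) - f t)"
    and g: "mono g" "antimono (\<lambda>t. g (t + 1) - g t)"
    and A: "A \<noteq> {}" "A \<subseteq> {..W}" "\<And>s. s \<in> A \<Longrightarrow> W - s \<in> A"
  shows "\<exists>t\<in>A. \<exists>\<delta>\<ge>0. (\<forall>s\<in>A. f s - \<delta> * real s \<le> f t - \<delta> * real t) \<and>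
    (\<forall>s\<in>A. g s - \<delta> * real s \<le> g (W - t) - \<delta> * real (W - t))"
proof -
  have "finite A"
    using A(2) finite_subset by blast
  define h where "h s = f s + g (W - s)" for s
  obtain t where "is_arg_min (\<lambda>s. - h s) (\<lambda>s. s \<in> A) t"
    using ex_is_arg_min_if_finite[OF \<open>finite A\<close> A(1)] by blast
  then have t: "t \<in> A" and max: "\<forall>s\<in>A. h s \<le> h t"
    by (auto simp: is_arg_min_linorder)
  have opt: "f s + g (W - s) \<le> f t + g (W - t)" if "s \<in> A" for s
    using bspec[OF max that] by (simp add: h_def)
  have "t \<le> W"
    using t A by auto
  \<comment> \<open>The same optimality with the firms exchanged, so that
    \<open>slope_exchange\<close> applies in both directions.\<close>
  have opt': "g s + f (W - s) \<le> g (W - t) + f (W - (W - t))" if "s \<in> A" for s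
    using opt[OF A(3)[OF that]] A(2) that \<open>t \<le> W\<close> by (auto simp: add.commute)
  define slopes where "slopes h b = (\<lambda>s. (h s - h b) / (real s - real b)) ` {s \<in> A. b < s}"
    for h :: "nat \<Rightarrow> real" and b
  \<comment> \<open>The least nonnegative number above all right slopes. The element 0 also keeps
    the set nonempty when there are no right slopes.\<close>
  define \<delta> where "\<delta> = Max (insert 0 (slopes f t \<union> slopes g (W - t)))"
  have fin: "finite (insert 0 (slopes f t \<union> slopes g (W - t)))"
    using \<open>finite A\<close> by (auto simp: slopes_def)
  have "0 \<le> \<delta>"
    unfolding \<delta>_def using fin by (intro Max_ge) auto
  moreover have "f s - \<delta> * real s \<le> f t - \<delta> * real t" if "s \<in> A" for s
  proof (rule slope_bounds_maximizer[OF _ _ that])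
    show "(f s - f t) / (real s - real t) \<le> \<delta>" if "s \<in> A" "t < s" for s
      unfolding \<delta>_def using fin that by (intro Max_ge) (auto simp: slopes_def)
    show "\<delta> \<le> (f t - f s) / (real t - real s)" if "s \<in> A" "s < t" for s
      unfolding \<delta>_def
    proof (rule Max.boundedI[OF fin])
      fix r assume "r \<in> insert 0 (slopes f t \<union> slopes g (W - t))"
      then consider "r = 0"
        | u where "u \<in> A" "t < u" "r = (f u - f t) / (real u - real t)"
        | u where "u \<in> A" "W - t < u" "r = (g u - g (W - t)) / (real u - real (W - t))"
        by (auto simp: slopes_def)
      \<comment> \<open>A left slope of \<open>f\<close> dominates 0 by monotonicity, the right
        slopes of \<open>f\<close> by concavity, and those of \<open>g\<close> by optimality of the
        split.\<close>
      then show "r \<le> (f t - f s) / (real t - real s)"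
      proof cases
        case 1
        then show ?thesis
          using monoD[OF f(1), of s t] that by simp
      next
        case 2
        then show ?thesis
          using concave_slopes[OF f(2)] that by blast
      next
        case 3
        then show ?thesis
          using slope_exchange[OF g(2) f(2) A(2,3) opt', of u s] that \<open>t \<le> W\<close> by simp
      qed
    qed simp
  qed
  moreover have "g s - \<delta> * real s \<le> g (W - t) - \<delta> * real (W - t)" if "s \<in> A" for s
  proof (rule slope_bounds_maximizer[OF _ _ that])
    show "(g s - g (W - t)) / (real s - real (W - t)) \<le> \<delta>" if "s \<in> A" "W - t < s" for s
      unfolding \<delta>_def using fin that by (intro Max_ge) (auto simp: slopes_def)
    show "\<delta> \<le> (g (W - t) - g s) / (real (W - t) - real s)" if "s \<in> A" "s < W - t" for s
      unfolding \<delta>_def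
    proof (rule Max.boundedI[OF fin])
      fix r assume "r \<in> insert 0 (slopes f t \<union> slopes g (W - t))"
      then consider "r = 0"
        | u where "u \<in> A" "t < u" "r = (f u - f t) / (real u - real t)"
        | u where "u \<in> A" "W - t < u" "r = (g u - g (W - t)) / (real u - real (W - t))"
        by (auto simp: slopes_def)
      then show "r \<le> (g (W - t) - g s) / (real (W - t) - real s)"
      proof cases
        case 1
        then show ?thesis
          using monoD[OF g(1), of s "W - t"] that by simp
      next
        case 2
        then show ?thesis
          using slope_exchange[OF f(2) g(2) A(2,3) opt, of u s] that by simp
      next
        case 3
        then show ?thesis
          using concave_slopes[OF g(2)] that by blast
      qed
    qed simp
  qed
  ultimately show ?thesis
    using t by blast
qed

theorem theorem4p1:
  fixes N :: "'a set" and K :: "'k set"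
    and w :: "'a \<Rightarrow> nat" and v :: "'k \<Rightarrow> nat \<Rightarrow> real"
  assumes "weighted_competition_game N K w v"
    and "card K = 2"
  shows "\<exists>P X. PSPE N K (weighted_value w v) P X \<and> (\<forall>i\<in>K. proportional N w (X i))"
proof -
  interpret weighted_competition_game N K w v by fact
  obtain a b where K: "K = {a, b}" "a \<noteq> b"
    using \<open>card K = 2\<close> by (auto simp: card_2_iff)
  have complement: "sum w N - sum w T = sum w (N - T)" if "T \<subseteq> N" for T
    using sum_diff_nat[of T N w] that finite_subset[OF that finite_workers] by simp
  \<comment> \<open>The attainable total weights; replacing a set of workers by its complement in
    \<open>N\<close> gives closure under \<open>sum w N - s\<close>. Profits at a price proportional
    to weight depend on a set only through its weight.\<close>
  define A where "A = sum w ` Pow N"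
  have "A \<noteq> {}" "A \<subseteq> {..sum w N}" "\<And>s. s \<in> A \<Longrightarrow> sum w N - s \<in> A"
    using finite_workers by (auto simp: A_def complement intro: sum_mono2)
  from supporting_price[OF value_mono marginals_antimono value_mono marginals_antimono this, of a b]
  \<comment> \<open>\<open>S\<close> is a set whose weight is the optimal split, so its complement
    realizes the remaining weight for the other firm.\<close>
  obtain S \<delta> where S: "S \<subseteq> N" and "0 \<le> \<delta>"
    and best_a: "\<And>T. T \<subseteq> N \<Longrightarrow> v a (sum w T) - \<delta> * real (sum w T)
      \<le> v a (sum w S) - \<delta> * real (sum w S)"
    and best_b: "\<And>T. T \<subseteq> N \<Longrightarrow> v b (sum w T) - \<delta> * real (sum w T)
      \<le> v b (sum w (N - S)) - \<delta> * real (sum w (N - S))"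
    by (auto simp: A_def K complement)
  define p where "p j = \<delta> * real (w j)" for j
  define P where "P = choice_partition N K (\<lambda>j. if j \<in> S then Some a else Some b)"
  have P: "P None = {}" "P (Some a) = S" "P (Some b) = N - S"
    using S K by (auto simp: P_def choice_partition_def options_def)
  have sum_p: "sum p T = \<delta> * real (sum w T)" for T
    by (simp add: p_def sum_distrib_left)
  have "PSPE N K (weighted_value w v) P (\<lambda>i\<in>K. \<lambda>j\<in>N. p j)"
  proof (rule walrasian_PSPE[OF finite_workers finite_firms two_firms])
    show "P \<in> partitions N K"
      using S K by (auto simp: P_def choice_partition_def partitions_def options_def
          disjoint_family_on_def)
    show "weighted_value w v i T - sum p T
        \<le> weighted_value w v i (P (Some i)) - sum p (P (Some i))" if "i \<in> K" "T \<subseteq> N" for i T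
      using that K best_a best_b by (auto simp: P sum_p weighted_value_def)
  qed (use \<open>0 \<le> \<delta>\<close> in \<open>auto simp: p_def P\<close>)
  moreover have "proportional N w ((\<lambda>i\<in>K. \<lambda>j\<in>N. p j) i)" if "i \<in> K" for i
    using that by (simp add: proportional_def p_def)
  ultimately show ?thesis
    by blast
qed

end
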